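(* Consider the downlink of a large-scale MIMO-OFDM system with $N$ subcarriers, $N_B$ base-station antennas, a single-antenna terminal, doubly selective channels of length $L$, the complex exponential basis expansion model (CE-BEM) with $D$ orders ($D$ odd), and the superimposed pilot pattern with guard pilots, all as described in the context. Let $\mathbf Y\in\mathbb C^N$ be the received frequency-domain signal, let $\mathbf P^{(n_B)}\in\mathbb C^{G\times 1}$ be the nonzero-pilot values of the $n_B$-th antenna, and let $\tilde{\mathbf P}^{(n_B)}=\mathrm{diag}(\mathbf P^{(n_B)})$. Then the estimation of the CE-BEM coefficients of all the transmit-receive antenna pairs, $\{\tilde{\boldsymbol\theta}_d^{(n_B)}\}$, $d\in\{0,\dots,D-1\}$, $n_B\in\{1,\dots,N_B\}$, is conducted by the following system of relations between the received pilots and the coefficients: for every $d\in\{0,\dots,D-1\}$, $$[\mathbf Y]_{\mathcal S_d}=\Big[\tilde{\mathbf P}^{(1)}[\mathbf W_L]_{\mathcal S_{\frac{D-1}{2}}}\ \cdots\ \tilde{\mathbf P}^{(N_B)}[\mathbf W_L]_{\mathcal S_{\frac{D-1}{2}}}\Big]\Big[(\tilde{\boldsymbol\theta}_d^{(1)})^T\ \cdots\ (\tilde{\boldsymbol\theta}_d^{(N_B)})^T\Big]^T+\boldsymbol\eta_d ,$$ where $\boldsymbol\eta_d$ is the noise term on the subcarriers $\mathcal S_d$.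
   Context: Vector and matrix indices start at $0$; subcarrier indices are $0,\dots,N-1$, read modulo $N$; $j^2=-1$. DFT: $\mathbf W\in\mathbb C^{N\times N}$ has entries $W[m,n]=N^{-1/2}e^{-j2\pi mn/N}$, and $\mathbf W_L\in\mathbb C^{N\times L}$ consists of its first $L$ columns. Channel and CE-BEM: $h^{(n_B)}[n,l]$ is the channel coefficient of tap $l\in\{0,\dots,L-1\}$ at time instant $n\in\{0,\dots,N-1\}$ between base-station antenna $n_B\in\{1,\dots,N_B\}$ and the terminal. For each tap, $(h^{(n_B)}[0,l],\dots,h^{(n_B)}[N-1,l])^T=\sum_{d=0}^{D-1}\theta^{(n_B)}[d,l]\,\mathbf v_d$ up to a modeling error, which is neglected, where $\mathbf v_d\in\mathbb C^N$ has entries $e^{j\frac{2\pi}{N}n(d-\frac{D-1}{2})}$, $n=0,\dots,N-1$. The CE-BEM coefficient vector of order $d$ and antenna $n_B$ is $\tilde{\boldsymbol\theta}_d^{(n_B)}=(\theta^{(n_B)}[d,0],\dots,\theta^{(n_B)}[d,L-1])^T\in\mathbb C^{L}$. The frequency-domain channel matrix is $\mathbf H_f^{(n_B)}=\sum_{d=0}^{D-1}\mathbf V_d\boldsymbol\Theta_d^{(n_B)}$, with $\mathbf V_d=\mathbf W\,\mathrm{diag}(\mathbf v_d)\,\mathbf W^H$ and $\boldsymbol\Theta_d^{(n_B)}=\mathrm{diag}\big(\sqrt N\,\mathbf W[(\tilde{\boldsymbol\theta}_d^{(n_B)})^T,\mathbf 0_{1\times(N-L)}]^T\big)$. Received signal: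 $\mathbf Y=\sum_{n_B=1}^{N_B}\mathbf H_f^{(n_B)}\mathbf S^{(n_B)}+\boldsymbol\Upsilon$, where $\mathbf S^{(n_B)}\in\mathbb C^N$ is the frequency-domain signal transmitted by antenna $n_B$ and $\boldsymbol\Upsilon$ is the noise term. Pilot pattern: the $G$ nonzero-pilot positions $\mathcal S_{cen}=\{s_1,\dots,s_G\}$ are the same for all antennas, and distinct positions differ by at least $2D-1$. For every antenna, $S^{(n_B)}[s_g]$ is the $g$-th entry of $\mathbf P^{(n_B)}$, and each nonzero pilot is accompanied by $D-1$ zero guard pilots on each side, i.e. $S^{(n_B)}[s_g+e]=0$ for $1\le|e|\le D-1$; the other subcarriers carry data. The central $D$ pilots of each group are used for estimation: $\mathcal S_d=\mathcal S_{cen}+d-\frac{D-1}{2}$ (elementwise) for $d\in\{0,\dots,D-1\}$, so that $\mathcal S_{\frac{D-1}{2}}=\mathcal S_{cen}$. For an index set $\mathcal S$, $[\mathbf A]_{\mathcal S}$ denotes the rows of $\mathbf A$ (or entries, for a vector) indexed by $\mathcal S$.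
   Formalization: The block matrix on the right-hand side is multiplied by √N: with the unitary DFT matrix W and Θ_d = diag(√N W[θ_d; 0]), the displayed relation without this factor is false for N ≥ 2; the noise term η_d is taken to be the restriction of Υ to S_d. *)

theory Defs
  imports Complex_Main "Jordan_Normal_Form.Schur_Decomposition"
begin

definition dft :: "nat \<Rightarrow> complex mat" where
  "dft N = mat N N (\<lambda>(m, n). of_real (1 / sqrt (real N)) * cis (- (2 * pi * real m * real n / real N)))"

definition dft_cols :: "nat \<Rightarrow> nat \<Rightarrow> complex mat" where
  "dft_cols N L = mat N L (\<lambda>(m, l). dft N $$ (m, l))"

definition diag_of :: "complex vec \<Rightarrow> complex mat" where
  "diag_of v = mat_diag (dim_vec v) (\<lambda>i. v $ i)"

text \<open>Block row \<open>[A\<^sub>1 \<dots> A\<^sub>k]\<close> of matrices with \<open>r\<close> rows, and the stacked column of vectors.\<close>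

definition block_row :: "nat \<Rightarrow> complex mat list \<Rightarrow> complex mat" where
  "block_row r As = mat_of_cols r (concat (map cols As))"

definition stack_vec :: "complex vec list \<Rightarrow> complex vec" where
  "stack_vec vs = vec_of_list (concat (map list_of_vec vs))"

text \<open>
  Index sets are enumerated families \<open>f\<close> of \<open>G\<close> indices rather than sets: reducing shifted
  positions modulo \<open>N\<close> can change their increasing order, while the rows have to stay aligned
  with the pilot numbering.
\<close>

definition rows_at :: "nat \<Rightarrow> (nat \<Rightarrow> nat) \<Rightarrow> complex mat \<Rightarrow> complex mat" where
  "rows_at G f A = mat G (dim_col A) (\<lambda>(g, l). A $$ (f g, l))"

definition entries_at :: "nat \<Rightarrow> (nat \<Rightarrow> nat) \<Rightarrow> complex vec \<Rightarrow> complex vec" where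
  "entries_at G f v = vec G (\<lambda>g. v $ f g)"

definition subcarrier :: "nat \<Rightarrow> int \<Rightarrow> nat" where
  "subcarrier N i = nat (i mod int N)"

definition bem_vec :: "nat \<Rightarrow> nat \<Rightarrow> nat \<Rightarrow> complex vec" where
  "bem_vec N D d = vec N (\<lambda>n. cis (2 * pi / real N * real n * (real d - (real D - 1) / 2)))"

text \<open>
  In the following, \<open>\<theta> d l\<close> is the coefficient of order \<open>d\<close> and tap \<open>l\<close>, and \<open>h n l\<close> is the
  channel coefficient of tap \<open>l\<close> at time \<open>n\<close>, for one antenna.
\<close>

definition ce_bem :: "nat \<Rightarrow> nat \<Rightarrow> nat \<Rightarrow> (nat \<Rightarrow> nat \<Rightarrow> complex) \<Rightarrow> (nat \<Rightarrow> nat \<Rightarrow> complex) \<Rightarrow> bool" where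
  "ce_bem N L D h \<theta> \<longleftrightarrow>
     (\<forall>l<L. vec N (\<lambda>n. h n l) = vec N (\<lambda>n. \<Sum>d<D. \<theta> d l * bem_vec N D d $ n))"

definition coeff_vec :: "nat \<Rightarrow> (nat \<Rightarrow> nat \<Rightarrow> complex) \<Rightarrow> nat \<Rightarrow> complex vec" where
  "coeff_vec L \<theta> d = vec L (\<lambda>l. \<theta> d l)"

definition bem_mat :: "nat \<Rightarrow> nat \<Rightarrow> nat \<Rightarrow> complex mat" where
  "bem_mat N D d = dft N * diag_of (bem_vec N D d) * mat_adjoint (dft N)"

definition coeff_mat :: "nat \<Rightarrow> nat \<Rightarrow> (nat \<Rightarrow> nat \<Rightarrow> complex) \<Rightarrow> nat \<Rightarrow> complex mat" where
  "coeff_mat N L \<theta> d =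
     diag_of (of_real (sqrt (real N)) \<cdot>\<^sub>v (dft N *\<^sub>v (coeff_vec L \<theta> d @\<^sub>v 0\<^sub>v (N - L))))"

definition freq_channel :: "nat \<Rightarrow> nat \<Rightarrow> nat \<Rightarrow> (nat \<Rightarrow> nat \<Rightarrow> complex) \<Rightarrow> complex mat" where
  "freq_channel N L D \<theta> =
     mat N N (\<lambda>(m, k). \<Sum>d<D. (bem_mat N D d * coeff_mat N L \<theta> d) $$ (m, k))"

definition received :: "nat \<Rightarrow> nat \<Rightarrow> nat \<Rightarrow> nat \<Rightarrow> (nat \<Rightarrow> nat \<Rightarrow> nat \<Rightarrow> complex) \<Rightarrow>
    (nat \<Rightarrow> complex vec) \<Rightarrow> complex vec \<Rightarrow> complex vec" where
  "received N NB L D \<theta> S \<Upsilon> =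
     vec N (\<lambda>m. \<Sum>b = 1..NB. (freq_channel N L D (\<theta> b) *\<^sub>v S b) $ m) + \<Upsilon>"

definition pilot_positions :: "nat \<Rightarrow> nat \<Rightarrow> nat \<Rightarrow> (nat \<Rightarrow> nat) \<Rightarrow> bool" where
  "pilot_positions N D G s \<longleftrightarrow>
     (\<forall>g<G. s g < N) \<and>
     (\<forall>g<G. \<forall>g'<G. g \<noteq> g' \<longrightarrow> 2 * int D - 1 \<le> \<bar>int (s g) - int (s g')\<bar>)"

definition pilot_signal :: "nat \<Rightarrow> nat \<Rightarrow> nat \<Rightarrow> (nat \<Rightarrow> nat) \<Rightarrow> complex vec \<Rightarrow> complex vec \<Rightarrow> bool" where
  "pilot_signal N D G s P S \<longleftrightarrow>
     S \<in> carrier_vec N \<and> P \<in> carrier_vec G \<and>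
     (\<forall>g<G. P $ g \<noteq> 0 \<and> S $ s g = P $ g) \<and>
     (\<forall>g<G. \<forall>e::int. 1 \<le> \<bar>e\<bar> \<and> \<bar>e\<bar> \<le> int D - 1 \<longrightarrow> S $ subcarrier N (int (s g) + e) = 0)"

text \<open>
  The \<open>g\<close>-th element of \<open>\<S>\<^sub>d\<close>, read modulo \<open>N\<close>; the division is exact for odd \<open>D\<close>.
\<close>

definition shifted_pilots :: "nat \<Rightarrow> nat \<Rightarrow> (nat \<Rightarrow> nat) \<Rightarrow> nat \<Rightarrow> nat \<Rightarrow> nat" where
  "shifted_pilots N D s d g = subcarrier N (int (s g) + int d - int ((D - 1) div 2))"

text \<open>
  \<open>[diag P\<^sub>1 [W\<^sub>L]\<^sub>f \<dots> diag P\<^bsub>NB\<^esub> [W\<^sub>L]\<^sub>f]\<close>, with \<open>W\<^sub>L\<close> taken from the unitary DFT matrix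
  and \<open>f\<close> enumerating the central pilot positions.
  The channel matrix uses \<open>sqrt N\<close> times the unitary DFT of the coefficients, so the identity
  between the received pilots and the coefficients carries a factor \<open>sqrt N\<close> in front of
  this matrix.
\<close>

definition pilot_mat :: "nat \<Rightarrow> nat \<Rightarrow> nat \<Rightarrow> nat \<Rightarrow> (nat \<Rightarrow> nat) \<Rightarrow> (nat \<Rightarrow> complex vec) \<Rightarrow> complex mat" where
  "pilot_mat N NB L G f P =
     block_row G (map (\<lambda>b. diag_of (P b) * rows_at G f (dft_cols N L)) [1..<NB + 1])"

end

theory Submission
  imports Defs
begin

text \<open>For odd D the exponential v_d has the integer frequency e = d - (D-1)/2. Entry (m, k) of
  V_d = W diag(v_d) W^H is then 1/N times a sum of N-th roots of unity, which is 1 if k = m - e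
  modulo N and 0 otherwise: V_d is a cyclic shift (\<open>bem_mat_index\<close>). Since Theta_d' is
  diagonal, subcarrier m receives from order d' its diagonal entry times the transmitted value, both
  taken at m - d' + (D-1)/2 (\<open>freq_channel_mult\<close>).

  Reading Y at the pilot s_g shifted by order d makes order d' see the signal at s_g + (d - d'). As
  |d - d'| \<le> D - 1, a zero guard pilot stands there unless d' = d, so only P[g] times the
  order-d frequency response at s_g survives (\<open>freq_channel_mult_pilot\<close>). This response
  is sqrt N times row s_g of W_L applied to the coefficients. Summing over the antennas gives a row
  of the block matrix times the stacked coefficients (\<open>pilot_block_mult\<close>,
  \<open>block_row_mult_stack_vec\<close>).\<close>

section \<open>Sums of roots of unity\<close>

lemma cis_eq_1_imp_dvd:
  fixes k :: int
  assumes "0 < N" and "cis (2 * pi * real_of_int k / real N) = 1"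
  shows "int N dvd k"
proof -
  have "cos (2 * pi * real_of_int k / real N) = 1"
    using arg_cong[OF assms(2), of Re] by simp
  then obtain m :: int where "2 * pi * real_of_int k / real N = real_of_int m * (2 * pi)"
    by (auto simp: cos_one_2pi_int)
  then have "real_of_int k = real_of_int (m * int N)"
    using assms(1) by (simp add: field_simps)
  then show ?thesis
    by (simp only: of_int_eq_iff) simp
qed

text \<open>A geometric sum: its ratio z is an N-th root of unity, so the sum is N if z = 1 and (z^N
  - 1)/(z - 1) = 0 otherwise.\<close>

lemma sum_cis_roots:
  fixes k :: int
  assumes "0 < N"
  shows "(\<Sum>n<N. cis (2 * pi * real_of_int k / real N * real n)) =
    (if int N dvd k then of_nat N else 0)"
proof (cases "int N dvd k")
  case True
  then obtain q where k: "k = int N * q" ..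
  have "cis (2 * pi * real_of_int k / real N * real n) = 1" for n
  proof -
    have "2 * pi * real_of_int k / real N * real n = 2 * pi * real_of_int (q * int n)"
      using assms by (simp add: k)
    then show ?thesis by (metis cis_multiple_2pi Ints_of_int)
  qed
  then show ?thesis using True by simp
next
  case False
  define z where "z = cis (2 * pi * real_of_int k / real N)"
  have "z \<noteq> 1" using cis_eq_1_imp_dvd[OF assms] False by (auto simp: z_def)
  moreover have "z ^ N = 1"
    using assms cis_multiple_2pi[of "real_of_int k"] by (simp add: z_def DeMoivre mult_ac)
  moreover have "cis (2 * pi * real_of_int k / real N * real n) = z ^ n" for n
    by (simp add: z_def DeMoivre mult.commute)
  ultimately show ?thesis
    using False by (simp add: geometric_sum)
qed

section \<open>Basis matrices as cyclic shifts\<close>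

lemma dim_dft [simp]: "dim_row (dft N) = N" "dim_col (dft N) = N"
  by (simp_all add: dft_def)

lemma dim_bem_vec [simp]: "dim_vec (bem_vec N D d) = N"
  by (simp add: bem_vec_def)

lemma diag_of_carrier [simp]: "diag_of v \<in> carrier_mat (dim_vec v) (dim_vec v)"
  by (simp add: diag_of_def)

lemma index_mult_diag_of:
  assumes "A \<in> carrier_mat m (dim_vec v)" "i < m" "j < dim_vec v"
  shows "(A * diag_of v) $$ (i, j) = A $$ (i, j) * v $ j"
  unfolding diag_of_def using assms mat_diag_mult_right[OF assms(1)] by simp

lemma index_diag_of_mult:
  assumes "A \<in> carrier_mat (dim_vec v) m" "i < dim_vec v" "j < m"
  shows "(diag_of v * A) $$ (i, j) = v $ i * A $$ (i, j)"
  unfolding diag_of_def using assms mat_diag_mult_left[OF assms(1)] by simp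

lemma mat_adjoint_index:
  assumes "i < dim_col A" "j < dim_row A"
  shows "mat_adjoint A $$ (i, j) = conjugate (A $$ (j, i))"
  using assms by (simp add: mat_adjoint_def mat_of_rows_index)

lemma bem_mat_carrier: "bem_mat N D d \<in> carrier_mat N N"
  unfolding bem_mat_def by (intro carrier_matI) (simp_all add: mat_adjoint_def)

text \<open>For odd D this is the frequency d - (D-1)/2 of the basis vector; integer-valued because
  orders below the central one shift backwards.\<close>

definition bem_shift :: "nat \<Rightarrow> nat \<Rightarrow> int" where
  "bem_shift D d = int d - int ((D - 1) div 2)"

text \<open>Modulation in time is a cyclic shift in frequency: the phases of the three factors add
  up to a multiple of n, and orthogonality of the characters modulo N selects one column per
  row.\<close>

lemma bem_mat_index:
  assumes "0 < N" "odd D" "m < N" "k < N"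
  shows "bem_mat N D d $$ (m, k) =
    (if k = subcarrier N (int m - bem_shift D d) then 1 else 0)"
proof -
  \<comment> \<open>Oddness of D makes the halving exact, so the phase below is an integer multiple
    of 2 pi n / N.\<close>
  have half: "(real D - 1) / 2 = real_of_int (int ((D - 1) div 2))"
    using assms(2) by (auto elim!: oddE)
  \<comment> \<open>The net frequency: -m from the DFT, the shift from the basis vector, +k from the
    adjoint.\<close>
  define c where "c = bem_shift D d + int k - int m"
  have cis3: "(x * cis u) * cis v * (x * cis w) = x * x * cis (u + v + w)" for x u v w
    by (simp flip: cis_mult)
  have summand: "(dft N * diag_of (bem_vec N D d)) $$ (m, n) * mat_adjoint (dft N) $$ (n, k) =
      1 / of_nat N * cis (2 * pi * real_of_int c / real N * real n)" if "n < N" for n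
  proof -
    have "(dft N * diag_of (bem_vec N D d)) $$ (m, n) * mat_adjoint (dft N) $$ (n, k) =
        of_real (1 / sqrt (real N)) * of_real (1 / sqrt (real N)) *
        cis (- (2 * pi * real m * real n / real N) +
          2 * pi / real N * real n * (real d - (real D - 1) / 2) +
          2 * pi * real k * real n / real N)"
      unfolding cis3[symmetric] using that assms
      by (subst index_mult_diag_of[where m = N])
        (simp_all add: mat_adjoint_index dft_def bem_vec_def cis_cnj)
    also have "of_real (1 / sqrt (real N)) * of_real (1 / sqrt (real N)) = (1 / of_nat N :: complex)"
      by (simp flip: of_real_mult)
    also have "- (2 * pi * real m * real n / real N) +
          2 * pi / real N * real n * (real d - (real D - 1) / 2) +
          2 * pi * real k * real n / real N = 2 * pi * real_of_int c / real N * real n"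
      unfolding half c_def bem_shift_def using assms(1) by (simp add: field_simps)
    finally show ?thesis .
  qed
  have A: "dim_row (dft N * diag_of (bem_vec N D d)) = N" "dim_col (dft N * diag_of (bem_vec N D d)) = N"
    and B: "dim_row (mat_adjoint (dft N)) = N" "dim_col (mat_adjoint (dft N)) = N"
    by (simp_all add: mat_adjoint_def diag_of_def mat_diag_def)
  have "bem_mat N D d $$ (m, k) = (\<Sum>n<N. (dft N * diag_of (bem_vec N D d)) $$ (m, n) *
      mat_adjoint (dft N) $$ (n, k))"
    unfolding bem_mat_def using assms A B
    by (simp add: scalar_prod_def lessThan_atLeast0)
  also have "\<dots> = 1 / of_nat N * (\<Sum>n<N. cis (2 * pi * real_of_int c / real N * real n))"
    by (simp add: summand sum_distrib_left)
  also have "\<dots> = (if int N dvd c then 1 else 0)"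
    unfolding sum_cis_roots[OF assms(1)] using assms(1) by simp
  also have "int N dvd c \<longleftrightarrow> k = subcarrier N (int m - bem_shift D d)"
  \<comment> \<open>Divisibility gives only a congruence; k < N makes k its canonical
    representative.\<close>
  proof -
    have "int N dvd c \<longleftrightarrow> int k mod int N = (int m - bem_shift D d) mod int N"
      by (simp add: c_def mod_eq_dvd_iff algebra_simps)
    also have "\<dots> \<longleftrightarrow> int k = (int m - bem_shift D d) mod int N"
      using assms by simp
    also have "\<dots> \<longleftrightarrow> k = subcarrier N (int m - bem_shift D d)"
      unfolding subcarrier_def using assms(1) by (auto simp: nat_eq_iff)
    finally show ?thesis .
  qed
  finally show ?thesis by simp
qed

section \<open>Action of the channel on the pilots\<close>

lemma subcarrier_less: "0 < N \<Longrightarrow> subcarrier N i < N"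
  by (simp add: subcarrier_def nat_less_iff)

lemma subcarrier_shift:
  "0 < N \<Longrightarrow> subcarrier N (int (subcarrier N i) + j) = subcarrier N (i + j)"
  by (simp add: subcarrier_def mod_simps)

lemma subcarrier_id: "i < N \<Longrightarrow> subcarrier N (int i) = i"
  by (simp add: subcarrier_def)

text \<open>Frequency response of the order-d coefficients at subcarrier k: the k-th diagonal entry
  of Theta_d with the zero padding already dropped.\<close>

definition freq_coeff :: "nat \<Rightarrow> nat \<Rightarrow> (nat \<Rightarrow> nat \<Rightarrow> complex) \<Rightarrow> nat \<Rightarrow> nat \<Rightarrow> complex" where
  "freq_coeff N L \<theta> d k = of_real (sqrt (real N)) * (\<Sum>l<L. dft N $$ (k, l) * \<theta> d l)"

lemma coeff_mat_conv:
  assumes "L \<le> N"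
  shows "coeff_mat N L \<theta> d = diag_of (vec N (freq_coeff N L \<theta> d))"
proof -
  have "(\<Sum>l<N. dft N $$ (k, l) * (coeff_vec L \<theta> d @\<^sub>v 0\<^sub>v (N - L)) $ l) =
      (\<Sum>l<L. dft N $$ (k, l) * \<theta> d l)" if "k < N" for k
    using assms by (intro sum.mono_neutral_cong_right) (auto simp: coeff_vec_def)
  then have "of_real (sqrt (real N)) \<cdot>\<^sub>v (dft N *\<^sub>v (coeff_vec L \<theta> d @\<^sub>v 0\<^sub>v (N - L))) =
      vec N (freq_coeff N L \<theta> d)"
    using assms by (intro eq_vecI)
      (simp_all add: freq_coeff_def scalar_prod_def lessThan_atLeast0 coeff_vec_def)
  then show ?thesis by (simp add: coeff_mat_def)
qed

lemma freq_channel_index: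
  assumes "0 < N" "L \<le> N" "odd D" "m < N" "k < N"
  shows "freq_channel N L D \<theta> $$ (m, k) =
    (\<Sum>d<D. if k = subcarrier N (int m - bem_shift D d) then freq_coeff N L \<theta> d k else 0)"
  using assms
  by (simp add: freq_channel_def coeff_mat_conv index_mult_diag_of[where m = N]
      bem_mat_carrier bem_mat_index if_distrib[of "\<lambda>x. x * _"] cong: if_cong)

text \<open>Each order contributes at most one nonzero entry per row of the channel matrix, so after
  swapping the sums the sum over columns collapses.\<close>

lemma freq_channel_mult:
  assumes "0 < N" "L \<le> N" "odd D" "m < N" "S \<in> carrier_vec N"
  shows "(freq_channel N L D \<theta> *\<^sub>v S) $ m =
    (\<Sum>d<D. freq_coeff N L \<theta> d (subcarrier N (int m - bem_shift D d)) *
       S $ subcarrier N (int m - bem_shift D d))"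
proof -
  let ?k = "\<lambda>d. subcarrier N (int m - bem_shift D d)"
  have "(freq_channel N L D \<theta> *\<^sub>v S) $ m = (\<Sum>k<N. freq_channel N L D \<theta> $$ (m, k) * S $ k)"
    using assms by (auto simp: freq_channel_def scalar_prod_def lessThan_atLeast0)
  also have "\<dots> = (\<Sum>k<N. \<Sum>d<D. if k = ?k d then freq_coeff N L \<theta> d k * S $ k else 0)"
    using assms by (auto simp: freq_channel_index sum_distrib_right intro!: sum.cong)
  also have "\<dots> = (\<Sum>d<D. \<Sum>k<N. if k = ?k d then freq_coeff N L \<theta> d k * S $ k else 0)"
    by (rule sum.swap)
  also have "\<dots> = (\<Sum>d<D. freq_coeff N L \<theta> d (?k d) * S $ ?k d)"
    using assms(1) by (simp add: sum.delta subcarrier_less)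
  finally show ?thesis .
qed

text \<open>
  The term of order \<open>d'\<close> at the subcarrier shifted by order \<open>d\<close> reads the signal at offset
  \<open>d - d'\<close> from the pilot, which is a guard pilot unless \<open>d' = d\<close>.
\<close>

lemma freq_channel_mult_pilot:
  assumes "0 < N" "L \<le> N" "odd D" "d < D" "g < G" "s g < N"
    and S: "pilot_signal N D G s P S"
  shows "(freq_channel N L D \<theta> *\<^sub>v S) $ shifted_pilots N D s d g =
    freq_coeff N L \<theta> d (s g) * P $ g"
proof -
  let ?m = "shifted_pilots N D s d g"
  \<comment> \<open>The half-widths (D-1)/2 of the two shifts cancel; wraparound is harmless because
    reductions modulo N compose.\<close>
  have "subcarrier N (int ?m - bem_shift D d') = subcarrier N (int (s g) + (int d - int d'))" for d'
    using subcarrier_shift[OF assms(1), of "int (s g) + int d - int ((D - 1) div 2)" "- bem_shift D d'"]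
    by (simp add: shifted_pilots_def bem_shift_def algebra_simps)
  moreover have "?m < N"
    using assms(1) by (simp add: shifted_pilots_def subcarrier_less)
  moreover have "S \<in> carrier_vec N" using S by (simp add: pilot_signal_def)
  ultimately have "(freq_channel N L D \<theta> *\<^sub>v S) $ ?m =
      (\<Sum>d'<D. freq_coeff N L \<theta> d' (subcarrier N (int (s g) + (int d - int d'))) *
         S $ subcarrier N (int (s g) + (int d - int d')))"
    using assms by (simp add: freq_channel_mult)
  also have "\<dots> = (\<Sum>d'<D. if d' = d then freq_coeff N L \<theta> d (s g) * P $ g else 0)"
  proof (intro sum.cong refl)
    fix d' assume "d' \<in> {..<D}"
    have "S $ subcarrier N (int (s g) + (int d - int d')) = 0" if "d' \<noteq> d"
    proof -
      have "1 \<le> \<bar>int d - int d'\<bar> \<and> \<bar>int d - int d'\<bar> \<le> int D - 1"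
        using that assms(4) \<open>d' \<in> {..<D}\<close> by auto
      then show ?thesis
        using S assms(5) unfolding pilot_signal_def by blast
    qed
    moreover have "S $ s g = P $ g"
      using S assms(5) by (simp add: pilot_signal_def)
    ultimately show "freq_coeff N L \<theta> d' (subcarrier N (int (s g) + (int d - int d'))) *
        S $ subcarrier N (int (s g) + (int d - int d')) =
        (if d' = d then freq_coeff N L \<theta> d (s g) * P $ g else 0)"
      using assms(6) by (simp add: subcarrier_id)
  qed
  also have "\<dots> = freq_coeff N L \<theta> d (s g) * P $ g"
    using assms(4) by simp
  finally show ?thesis .
qed

section \<open>Block matrices and the pilot system\<close>

text \<open>The product as a combination of columns, in a zipped form that splits along
  concatenations.\<close>

lemma mat_of_cols_mult_vec_of_list:
  assumes "length cs = length xs" "i < r"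
  shows "(mat_of_cols r cs *\<^sub>v vec_of_list xs) $ i = (\<Sum>(c, x)\<leftarrow>zip cs xs. c $ i * x)"
  using assms
  by (auto simp: scalar_prod_def sum_list_sum_nth mat_of_cols_index vec_of_list_index intro!: sum.cong)

lemma mult_mat_vec_index_sum:
  assumes "A \<in> carrier_mat m n" "dim_vec v = n" "i < m"
  shows "(A *\<^sub>v v) $ i = (\<Sum>j<n. A $$ (i, j) * v $ j)"
  using assms by (auto simp: scalar_prod_def lessThan_atLeast0)

lemma block_row_mult_stack_vec:
  assumes "\<And>b. b \<in> set bs \<Longrightarrow> A b \<in> carrier_mat r (dim_vec (v b))" and "i < r"
  shows "(block_row r (map A bs) *\<^sub>v stack_vec (map v bs)) $ i = (\<Sum>b\<leftarrow>bs. (A b *\<^sub>v v b) $ i)"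
proof -
  let ?cs = "\<lambda>bs. concat (map (\<lambda>b. cols (A b)) bs)"
  let ?xs = "\<lambda>bs. concat (map (\<lambda>b. list_of_vec (v b)) bs)"
  \<comment> \<open>Equality of lengths is carried through the induction: it keeps columns and
    entries aligned, and the column-combination formula needs it at the end.\<close>
  have "length (?cs bs) = length (?xs bs) \<and>
    (\<Sum>(c, x)\<leftarrow>zip (?cs bs) (?xs bs). c $ i * x) = (\<Sum>b\<leftarrow>bs. (A b *\<^sub>v v b) $ i)"
    using assms(1)
  proof (induction bs)
    case (Cons b bs)
    have A: "A b \<in> carrier_mat r (dim_vec (v b))" using Cons.prems by simp
    then have "(A b *\<^sub>v v b) $ i =
        (mat_of_cols r (cols (A b)) *\<^sub>v vec_of_list (list_of_vec (v b))) $ i"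
      using mat_of_cols_cols[of "A b"] by (simp only: carrier_matD(1)[OF A] vec_list)
    also have "\<dots> = (\<Sum>(c, x)\<leftarrow>zip (cols (A b)) (list_of_vec (v b)). c $ i * x)"
      using A assms(2) by (intro mat_of_cols_mult_vec_of_list) auto
    finally have "(A b *\<^sub>v v b) $ i = (\<Sum>(c, x)\<leftarrow>zip (cols (A b)) (list_of_vec (v b)). c $ i * x)" .
    moreover have "length (cols (A b)) = length (list_of_vec (v b))"
      using A by simp
    ultimately show ?case
      using Cons by (simp del: index_mult_mat_vec cols_length length_list_of_vec)
  qed simp
  then show ?thesis
    using assms(2) by (simp add: block_row_def stack_vec_def mat_of_cols_mult_vec_of_list o_def
        del: index_mult_mat_vec)
qed

text \<open>One antenna's share of the system; multiplied by sqrt N it is the pilot value times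
  \<open>freq_coeff\<close> at \<open>f g\<close>.\<close>

lemma pilot_block_mult:
  assumes "P \<in> carrier_vec G" "g < G" "f g < N"
  shows "(diag_of P * rows_at G f (dft_cols N L) *\<^sub>v coeff_vec L \<theta> d) $ g =
    P $ g * (\<Sum>l<L. dft N $$ (f g, l) * \<theta> d l)"
proof -
  have R: "rows_at G f (dft_cols N L) \<in> carrier_mat (dim_vec P) L"
    using assms(1) by (simp add: rows_at_def dft_cols_def carrier_vecD)
  then have M: "diag_of P * rows_at G f (dft_cols N L) \<in> carrier_mat G L"
    using assms(1) by (metis carrier_vecD diag_of_carrier mult_carrier_mat)
  have "(diag_of P * rows_at G f (dft_cols N L) *\<^sub>v coeff_vec L \<theta> d) $ g =
      (\<Sum>l<L. (diag_of P * rows_at G f (dft_cols N L)) $$ (g, l) * \<theta> d l)"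
    unfolding coeff_vec_def by (subst mult_mat_vec_index_sum[OF M]) (simp_all add: assms(2))
  also have "\<dots> = (\<Sum>l<L. P $ g * (dft N $$ (f g, l) * \<theta> d l))"
  proof (intro sum.cong refl)
    fix l assume "l \<in> {..<L}"
    then have l: "l < L" by simp
    have "rows_at G f (dft_cols N L) $$ (g, l) = dft N $$ (f g, l)"
      using assms l by (simp add: rows_at_def dft_cols_def)
    then show "(diag_of P * rows_at G f (dft_cols N L)) $$ (g, l) * \<theta> d l =
        P $ g * (dft N $$ (f g, l) * \<theta> d l)"
      using assms l by (subst index_diag_of_mult[OF R]) auto
  qed
  finally show ?thesis by (simp add: sum_distrib_left)
qed

theorem theorem2:
  fixes N NB L D G :: nat
    and h \<theta> :: "nat \<Rightarrow> nat \<Rightarrow> nat \<Rightarrow> complex"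
    and s :: "nat \<Rightarrow> nat"
    and P S :: "nat \<Rightarrow> complex vec"
    and Y \<Upsilon> :: "complex vec"
  assumes "0 < N" and "L \<le> N" and "odd D"
    and "\<And>b. b \<in> {1..NB} \<Longrightarrow> ce_bem N L D (h b) (\<theta> b)"
    and "pilot_positions N D G s"
    and "\<And>b. b \<in> {1..NB} \<Longrightarrow> pilot_signal N D G s (P b) (S b)"
    and "\<Upsilon> \<in> carrier_vec N"
    and "Y = received N NB L D \<theta> S \<Upsilon>"
  shows "\<forall>d<D. entries_at G (shifted_pilots N D s d) Y =
      of_real (sqrt (real N)) \<cdot>\<^sub>v
        (pilot_mat N NB L G (shifted_pilots N D s ((D - 1) div 2)) P *\<^sub>v
           stack_vec (map (\<lambda>b. coeff_vec L (\<theta> b) d) [1..<NB + 1]))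
      + entries_at G (shifted_pilots N D s d) \<Upsilon>"
proof (intro allI impI eq_vecI)
  fix d g
  let ?f = "shifted_pilots N D s ((D - 1) div 2)"
  let ?A = "\<lambda>b. diag_of (P b) * rows_at G ?f (dft_cols N L)"
  let ?v = "\<lambda>b. coeff_vec L (\<theta> b) d"
  assume d: "d < D" and "g < dim_vec (of_real (sqrt (real N)) \<cdot>\<^sub>v
        (pilot_mat N NB L G ?f P *\<^sub>v stack_vec (map ?v [1..<NB + 1]))
      + entries_at G (shifted_pilots N D s d) \<Upsilon>)"
  then have g: "g < G" by (simp add: entries_at_def)
  then have sg: "s g < N" using assms(5) by (simp add: pilot_positions_def)
  \<comment> \<open>The central order has shift zero.\<close>
  then have fg: "?f g = s g" by (simp add: shifted_pilots_def subcarrier_id)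
  have m: "shifted_pilots N D s d g < N"
    using assms(1) by (simp add: shifted_pilots_def subcarrier_less)
  have P: "P b \<in> carrier_vec G" if "b \<in> {1..NB}" for b
    using assms(6)[OF that] by (simp add: pilot_signal_def)
  have A: "?A b \<in> carrier_mat G (dim_vec (?v b))" if "b \<in> set [1..<NB + 1]" for b
    using P[of b] that by (intro carrier_matI) (auto simp: diag_of_def mat_diag_def rows_at_def dft_cols_def coeff_vec_def)
  have "of_real (sqrt (real N)) *
      (pilot_mat N NB L G ?f P *\<^sub>v stack_vec (map ?v [1..<NB + 1])) $ g =
      of_real (sqrt (real N)) * (\<Sum>b\<leftarrow>[1..<NB + 1]. (?A b *\<^sub>v ?v b) $ g)"
    unfolding pilot_mat_def by (subst block_row_mult_stack_vec[OF A g]) auto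
  also have "(\<Sum>b\<leftarrow>[1..<NB + 1]. (?A b *\<^sub>v ?v b) $ g) = (\<Sum>b = 1..NB. (?A b *\<^sub>v ?v b) $ g)"
    by (subst interv_sum_list_conv_sum_set_nat) (intro sum.cong; auto)
  \<comment> \<open>Distributed over the antennas, sqrt N becomes the normalisation inside
    \<open>freq_coeff\<close>, so the identity can be checked antenna by antenna.\<close>
  also have "of_real (sqrt (real N)) * \<dots> =
      (\<Sum>b = 1..NB. (freq_channel N L D (\<theta> b) *\<^sub>v S b) $ shifted_pilots N D s d g)"
    unfolding sum_distrib_left
  proof (intro sum.cong refl)
    fix b assume b: "b \<in> {1..NB}"
    show "of_real (sqrt (real N)) * (?A b *\<^sub>v ?v b) $ g =
        (freq_channel N L D (\<theta> b) *\<^sub>v S b) $ shifted_pilots N D s d g"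
      using pilot_block_mult[OF P[OF b] g, of ?f N L "\<theta> b" d]
        freq_channel_mult_pilot[OF assms(1-3) d g sg assms(6)[OF b], of "\<theta> b"] sg
      unfolding fg by (simp add: freq_coeff_def)
  qed
  finally have *: "of_real (sqrt (real N)) *
      (pilot_mat N NB L G ?f P *\<^sub>v stack_vec (map ?v [1..<NB + 1])) $ g =
      (\<Sum>b = 1..NB. (freq_channel N L D (\<theta> b) *\<^sub>v S b) $ shifted_pilots N D s d g)" .
  have "dim_row (pilot_mat N NB L G ?f P) = G"
    by (simp add: pilot_mat_def block_row_def)
  then show "entries_at G (shifted_pilots N D s d) Y $ g =
      (of_real (sqrt (real N)) \<cdot>\<^sub>v
        (pilot_mat N NB L G ?f P *\<^sub>v stack_vec (map ?v [1..<NB + 1]))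
      + entries_at G (shifted_pilots N D s d) \<Upsilon>) $ g"
    using * g m assms(7) unfolding assms(8) received_def
    by (simp add: entries_at_def del: index_mult_mat_vec)
qed (simp add: entries_at_def)

end
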